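(* Let $r\in(0,1)$ and $\lambda>0$. Set $$A:=2^{r\delta}\sqrt{\Big(\frac{2\lambda}{\tau}\Big)^{2\delta}+\lambda^2},\qquad k_0:=\max\left\{\left(\frac{4r\delta A^{\frac{2\delta-1}{\delta}}}{\lambda\tau}\right)^{\frac1{1-2r(1-\delta)}},\ A^{\frac1{\delta r}}\Big(\frac{2\rho}{\mu}\Big)^{\frac1{r(\delta(1+\nu)-1)}},\ 1\right\}.$$ Let $\{x_k\}_{k\ge0}$ be generated by the projected subgradient method with step-size $\alpha_k=\lambda(k+k_0)^{-r}$ and initial point $x_0\in\mathcal{T}_{1/2}$ satisfying $\operatorname{dist}(x_0;\mathcal{X}^* )\le\min\big\{(2\lambda/\tau)^\delta,\ Ak_0^{-\delta r}\big\}$. Then, for all $k\ge0$, $$\operatorname{dist}(x_k;\mathcal{X}^* )\le\frac{A}{(k+k_0)^{\delta r}}.$$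
   Context: $\|\cdot\|$ is the Euclidean norm on $\mathbb{R}^n$, $\operatorname{dist}(x;S)=\inf_{z\in S}\|z-x\|$, $\operatorname{proj}_X$ is the Euclidean projection onto $X$, $\operatorname{dom}(f)=\{x:f(x)<+\infty\}$, and $\partial f$ is the Clarke subdifferential. Standing assumptions: $f:\mathbb{R}^n\to\mathbb{R}\cup\{+\infty\}$ is proper; $X\subseteq\operatorname{dom}(f)$ is nonempty, closed and convex; the set of minimizers $\mathcal{X}^*=\operatorname{argmin}_{x\in X}f(x)$ is nonempty and $f^*$ is the minimal value of $f$ over $X$. The parameters satisfy $\rho>0$, $0<\nu\le1$, $\frac1{1+\nu}<\delta\le1$, $\mu>0$, and: (i) $f$ is $\nu$-paraconvex with constant $\rho$ on an open convex set $X'$ with $X\subseteq X'\subseteq\operatorname{dom}(f)$, i.e. $f(\lambda x+(1-\lambda)y)\le\lambda f(x)+(1-\lambda)f(y)+\rho\min\{\lambda,1-\lambda\}\|x-y\|^{1+\nu}$ for all $x,y\in X'$, $\lambda\in[0,1]$ (consequently $f$ is locally Lipschitz on $X'$); (ii) Hölderian error bound: $\mu\operatorname{dist}^{1/\delta}(x;\mathcal{X}^* )\le f(x)-f^*$ for all $x\in X$. For $\gamma\in(0,1]$ let $\mathcal{T}_\gamma=\big\{x\in X:\operatorname{dist}(x;\mathcal{X}^* )<(\gamma\mu/\rho)^{\delta/(\delta(1+\nu)-1)}\big\}$. Let $L=\sup\{\|\zeta\|:\zeta\in\partial f(x),\ x\in\mathcal{T}_1\}$, with $0<L<\infty$, and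 $\tau=\mu/L$. Projected subgradient method with step-sizes $\alpha_k$: from the initial point, at each iteration choose any $\zeta_k\in\partial f(x_k)$ and set $x_{k+1}=\operatorname{proj}_X\big(x_k-\alpha_k\zeta_k/\|\zeta_k\|\big)$; if $\zeta_k=0$, set $x_{k+1}=x_k$. *)

theory Defs
  imports "HOL-Analysis.Analysis"
begin

text \<open>Functions with values in \<open>\<real> \<union> {+\<infinity>}\<close> are rendered as \<open>ereal\<close>-valued functions;
  \<open>proper_fun\<close> excludes the value \<open>-\<infinity>\<close>.\<close>

definition edom :: "('a \<Rightarrow> ereal) \<Rightarrow> 'a set" where
  "edom f = {x. f x < \<infinity>}"

definition proper_fun :: "('a \<Rightarrow> ereal) \<Rightarrow> bool" where
  "proper_fun f \<longleftrightarrow> (\<forall>x. f x \<noteq> -\<infinity>) \<and> edom f \<noteq> {}"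

definition argmin_set :: "('a \<Rightarrow> ereal) \<Rightarrow> 'a set \<Rightarrow> 'a set" where
  "argmin_set f X = {x. is_arg_min f (\<lambda>y. y \<in> X) x}"

definition paraconvex_on ::
    "('a::real_normed_vector) set \<Rightarrow> real \<Rightarrow> real \<Rightarrow> ('a \<Rightarrow> ereal) \<Rightarrow> bool" where
  "paraconvex_on S \<nu> \<rho> f \<longleftrightarrow>
     (\<forall>x\<in>S. \<forall>y\<in>S. \<forall>l\<in>{0..1}.
        f (l *\<^sub>R x + (1 - l) *\<^sub>R y)
          \<le> ereal l * f x + ereal (1 - l) * f y
             + ereal (\<rho> * min l (1 - l) * norm (x - y) powr (1 + \<nu>)))"

text \<open>Clarke's generalized directional derivative
  \<open>f\<degree>(x; v) = limsup (f (y + t v) - f y) / t\<close> as \<open>y \<rightarrow> x\<close> and \<open>t \<down> 0\<close>, and the subdifferential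
  it supports. This is Clarke's definition for functions that are finite and Lipschitz near \<open>x\<close>;
  at other points (where \<open>\<infinity> - \<infinity>\<close> may occur) the value carries no meaning.\<close>

definition clarke_dir_deriv :: "('a::real_inner \<Rightarrow> ereal) \<Rightarrow> 'a \<Rightarrow> 'a \<Rightarrow> ereal" where
  "clarke_dir_deriv f x v =
     Limsup (nhds x \<times>\<^sub>F at_right (0::real)) (\<lambda>(y, t). (f (y + t *\<^sub>R v) - f y) / ereal t)"

definition clarke_subdiff :: "('a::real_inner \<Rightarrow> ereal) \<Rightarrow> 'a \<Rightarrow> 'a set" where
  "clarke_subdiff f x = {\<zeta>. \<forall>v. ereal (\<zeta> \<bullet> v) \<le> clarke_dir_deriv f x v}"

definition holder_error_bound ::
    "('a::real_normed_vector \<Rightarrow> ereal) \<Rightarrow> 'a set \<Rightarrow> real \<Rightarrow> real \<Rightarrow> bool" where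
  "holder_error_bound f X \<mu> \<delta> \<longleftrightarrow>
     (\<forall>x\<in>X. ereal (\<mu> * infdist x (argmin_set f X) powr (1 / \<delta>)) \<le> f x - (INF y\<in>X. f y))"

text \<open>The region around the minimizers where the paraconvexity error \<open>\<rho> d powr (1 + \<nu>)\<close>, with
  \<open>d > 0\<close> the distance to the minimizers, is less than the fraction \<open>\<gamma>\<close> of the growth
  \<open>\<mu> d powr (1 / \<delta>)\<close>.\<close>

definition tube ::
    "('a::real_normed_vector \<Rightarrow> ereal) \<Rightarrow> 'a set \<Rightarrow> real \<Rightarrow> real \<Rightarrow> real \<Rightarrow> real \<Rightarrow> real \<Rightarrow> 'a set" where
  "tube f X \<rho> \<nu> \<delta> \<mu> \<gamma> =
     {x \<in> X. infdist x (argmin_set f X) < (\<gamma> * \<mu> / \<rho>) powr (\<delta> / (\<delta> * (1 + \<nu>) - 1))}"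

text \<open>\<open>x\<close> is a sequence of iterates with step-sizes \<open>\<alpha>\<close> and chosen subgradients \<open>\<zeta>\<close>;
  \<open>closest_point X\<close> is the Euclidean projection onto \<open>X\<close>.\<close>

definition proj_subgrad_method ::
    "('a::euclidean_space \<Rightarrow> ereal) \<Rightarrow> 'a set \<Rightarrow> (nat \<Rightarrow> real) \<Rightarrow> (nat \<Rightarrow> 'a) \<Rightarrow> (nat \<Rightarrow> 'a) \<Rightarrow> bool" where
  "proj_subgrad_method f X \<alpha> \<zeta> x \<longleftrightarrow>
     (\<forall>k. \<zeta> k \<in> clarke_subdiff f (x k) \<and>
          x (Suc k) = (if \<zeta> k = 0 then x k
                       else closest_point X (x k - (\<alpha> k / norm (\<zeta> k)) *\<^sub>R \<zeta> k)))"

end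

theory Submission
  imports Defs
begin

text \<open>
  Let \<open>d\<close> be the distance of the current iterate \<open>x\<close> to the set of minimizers and \<open>z\<close> a nearest
  minimizer. Paraconvexity turns a Clarke subgradient \<open>\<zeta>\<close> at \<open>x\<close> into a linear lower bound for \<open>f\<close>
  with the error \<open>\<rho> d powr (1 + \<nu>)\<close>; this is \<open>clarke_subgradient_inequality\<close>. The error bound makes
  \<open>f\<close> grow by \<open>\<mu> d powr (1 / \<delta>)\<close>. Since \<open>1 / \<delta> < 1 + \<nu>\<close>, growth beats the error close to the
  minimizers: in the tube of parameter \<open>1 / 2\<close> at least half of it survives, so that
  \<open>\<zeta> \<bullet> (x - z) \<ge> \<mu> / 2 * d powr (1 / \<delta>)\<close>. Expanding the square of the distance after a step of length
  \<open>\<alpha>\<close> and using that projections do not increase distances gives the recursion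
  \<open>d'\<^sup>2 \<le> d\<^sup>2 - \<alpha> * \<tau> * d powr (1 / \<delta>) + \<alpha>\<^sup>2\<close> of \<open>subgradient_step_distance\<close>.

  With \<open>K = k + k\<^sub>0\<close> and \<open>\<alpha> = lam * K powr (- r)\<close> it remains to see that the recursion preserves
  \<open>d \<le> A * K powr (- (\<delta> * r))\<close> when \<open>K\<close> increases by one (\<open>distance_rate_step\<close>). If
  \<open>\<tau> * d powr (1 / \<delta>) \<le> 2 * \<alpha>\<close>, then \<open>d\<close> is already of order \<open>K powr (- (\<delta> * r))\<close> and the increment
  \<open>\<alpha>\<^sup>2\<close> is of no larger order than \<open>K powr (- (2 * \<delta> * r))\<close>; the constant \<open>A\<close> is chosen for this case.
  Otherwise the decrease dominates the increment twice over, and \<open>d\<^sup>2 - \<alpha> * \<tau> / 2 * d powr (1 / \<delta>)\<close>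
  is at most its value at the largest admissible \<open>d\<close> (or is nonpositive). There the decrease has order
  \<open>K powr (- (2 * r))\<close>, whereas the target drops only by order \<open>K powr (- (2 * \<delta> * r) - 1)\<close>; since
  \<open>2 * r * (1 - \<delta>) < 1\<close> the former wins for large \<open>K\<close>, and the first entry of the maximum defining
  \<open>k\<^sub>0\<close> says how large. The second entry makes the claimed bound imply membership in the tube, which
  closes the induction.
\<close>

section \<open>Continuity of paraconvex functions\<close>

lemma paraconvex_on_realD:
  assumes "paraconvex_on S \<nu> \<rho> f" "convex S" and fin: "\<And>z. z \<in> S \<Longrightarrow> \<bar>f z\<bar> \<noteq> \<infinity>"
    and "x \<in> S" "y \<in> S" "0 \<le> l" "l \<le> 1"
  shows "real_of_ereal (f (l *\<^sub>R x + (1 - l) *\<^sub>R y))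
           \<le> l * real_of_ereal (f x) + (1 - l) * real_of_ereal (f y)
              + \<rho> * min l (1 - l) * norm (x - y) powr (1 + \<nu>)"
proof -
  let ?z = "l *\<^sub>R x + (1 - l) *\<^sub>R y"
  have z: "?z \<in> S"
    using assms by (intro convexD) auto
  have "f ?z \<le> ereal l * f x + ereal (1 - l) * f y
              + ereal (\<rho> * min l (1 - l) * norm (x - y) powr (1 + \<nu>))"
    using assms unfolding paraconvex_on_def by auto
  moreover obtain a b c where "f x = ereal a" "f y = ereal b" "f ?z = ereal c"
    using fin[OF \<open>x \<in> S\<close>] fin[OF \<open>y \<in> S\<close>] fin[OF z] by (metis ereal_real')
  ultimately show ?thesis
    by simp
qed

text \<open>Adding one vertex \<open>a\<close> to the polytope raises the bound to at most \<open>max (f a) B\<close> plus the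
  paraconvexity error of a segment, which is controlled by the diameter.\<close>

lemma paraconvex_bounded_above_convex_hull:
  fixes f :: "'a::euclidean_space \<Rightarrow> ereal"
  assumes f: "paraconvex_on S \<nu> \<rho> f" "convex S" "\<And>z. z \<in> S \<Longrightarrow> \<bar>f z\<bar> \<noteq> \<infinity>"
    and \<rho>: "0 \<le> \<rho>" "0 \<le> \<nu>" and T: "finite T" "T \<subseteq> S"
  shows "\<exists>B. \<forall>z\<in>convex hull T. real_of_ereal (f z) \<le> B"
  using T
proof (induction T rule: finite_induct)
  case empty
  then show ?case by simp
next
  case (insert a T)
  define g where "g z = real_of_ereal (f z)" for z
  show ?case
  proof (cases "T = {}")
    case True
    then show ?thesis by auto
  next
    case False
    obtain B where B: "\<And>z. z \<in> convex hull T \<Longrightarrow> g z \<le> B"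
      using insert unfolding g_def by auto
    have "bounded (convex hull (insert a T))"
      using insert.hyps by (simp add: finite_imp_bounded_convex_hull)
    then obtain D where D: "\<And>y z. y \<in> convex hull (insert a T) \<Longrightarrow> z \<in> convex hull (insert a T)
        \<Longrightarrow> dist y z \<le> D"
      using bounded_two_points by metis
    have "g z \<le> max (g a) B + \<rho> * D powr (1 + \<nu>)" if "z \<in> convex hull (insert a T)" for z
    proof -
      obtain u v b where uv: "0 \<le> u" "0 \<le> v" "u + v = 1" and b: "b \<in> convex hull T"
        and z: "z = u *\<^sub>R a + v *\<^sub>R b"
        using \<open>z \<in> _\<close> False by (auto simp: convex_hull_insert)
      have v: "v = 1 - u"
        using uv by simp
      have "convex hull T \<subseteq> S"
        using insert.prems f(2) by (simp add: hull_minimal)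
      then have "b \<in> S"
        using b by auto
      have "b \<in> convex hull insert a T"
        using b hull_mono[of T "insert a T"] by auto
      moreover have "a \<in> convex hull insert a T"
        by (simp add: hull_inc)
      ultimately have d: "norm (a - b) powr (1 + \<nu>) \<le> D powr (1 + \<nu>)"
        using D \<rho> by (intro powr_mono2) (auto simp: dist_norm)
      have "g z \<le> u * g a + (1 - u) * g b + \<rho> * min u (1 - u) * norm (a - b) powr (1 + \<nu>)"
        unfolding z v g_def
        using insert.prems \<open>b \<in> S\<close> uv by (intro paraconvex_on_realD[OF f]) auto
      also have "\<dots> \<le> u * max (g a) B + (1 - u) * max (g a) B + \<rho> * 1 * D powr (1 + \<nu>)"
        using uv \<rho> B[OF b] d by (intro add_mono mult_left_mono mult_mono[where a = "_ * _" and d = "_ powr _"]) auto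
      finally show ?thesis
        by (simp add: algebra_simps)
    qed
    then show ?thesis
      unfolding g_def by auto
  qed
qed

text \<open>The argument for convex functions carries over, as the error term is proportional to the weight
  \<open>min l (1 - l)\<close> and so vanishes with the step from the nearer endpoint. Around \<open>x\<close> there is a box, hence a polytope, on which \<open>f\<close> is bounded above. For \<open>y\<close>
  near \<open>x\<close>, paraconvexity on the segment from \<open>x\<close> through \<open>y\<close> to the sphere of radius \<open>s\<close> bounds
  \<open>f y - f x\<close> from above. The same for \<open>x\<close> as a point between \<open>y\<close> and the opposite point of the sphere
  bounds it from below. Both bounds are linear in \<open>norm (y - x)\<close>.\<close>

lemma paraconvex_isCont:
  fixes f :: "'a::euclidean_space \<Rightarrow> ereal"
  assumes f: "paraconvex_on S \<nu> \<rho> f" "convex S" "\<And>z. z \<in> S \<Longrightarrow> \<bar>f z\<bar> \<noteq> \<infinity>"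
    and \<rho>: "0 \<le> \<rho>" "0 \<le> \<nu>" and S: "open S" "x \<in> S"
  shows "isCont (\<lambda>z. real_of_ereal (f z)) x"
proof -
  define g where "g z = real_of_ereal (f z)" for z
  obtain a b where ab: "cbox a b \<subseteq> S" "x \<in> box a b"
    by (rule open_contains_cbox[OF S])
  obtain T where T: "finite T" "cbox a b = convex hull T"
    using polytope_interval[of a b] unfolding polytope_def by auto
  have "T \<subseteq> S"
    using hull_subset[of T convex] ab(1) unfolding T(2)[symmetric] by (rule order_trans)
  then obtain B where B: "\<And>z. z \<in> cbox a b \<Longrightarrow> g z \<le> B"
    using paraconvex_bounded_above_convex_hull[OF f \<rho> T(1)] T(2) unfolding g_def by metis
  obtain s where s: "0 < s" "cball x s \<subseteq> box a b"
    using ab open_contains_cball[of "box a b"] open_box by metis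
  have sb: "cball x s \<subseteq> cbox a b"
    using s box_subset_cbox by blast
  define C where "C = B - g x + \<rho> * (2 * s) powr (1 + \<nu>)"
  have bound: "norm (g y - g x) \<le> C / s * norm (y - x)" if y: "y \<in> ball x s" for y
  proof (cases "y = x")
    case True
    then show ?thesis by simp
  next
    case False
    define t where "t = norm (y - x) / s"
    have t: "0 < t" "t \<le> 1" "t * s = norm (y - x)"
      using False y s by (auto simp: t_def dist_norm norm_minus_commute)
    define e where "e = (1 / t) *\<^sub>R (y - x)"
    have e: "norm e = s"
      using t unfolding e_def by (simp flip: t(3))
    have "y \<in> cball x s" "x + e \<in> cball x s" "x - e \<in> cball x s"
      using y e by (auto simp: dist_norm)
    then have yc: "y \<in> cbox a b" "x + e \<in> cbox a b" "x - e \<in> cbox a b"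
      using sb by blast+
    then have yS: "y \<in> S" "x + e \<in> S" "x - e \<in> S" and ge: "g (x + e) \<le> B" "g (x - e) \<le> B"
      using ab B by blast+
    have y_eq: "y = t *\<^sub>R (x + e) + (1 - t) *\<^sub>R x"
      using t by (simp add: e_def algebra_simps)
    have "g y \<le> t * g (x + e) + (1 - t) * g x + \<rho> * min t (1 - t) * norm (x + e - x) powr (1 + \<nu>)"
      using paraconvex_on_realD[OF f yS(2) S(2), of t] t unfolding y_eq[symmetric] g_def by simp
    also have "\<dots> \<le> t * B + (1 - t) * g x + \<rho> * t * (2 * s) powr (1 + \<nu>)"
      using t e ge \<rho> s by (intro add_mono mult_left_mono mult_mono[where a = "_ * _" and d = "_ powr _"] powr_mono2) auto
    finally have upper: "g y - g x \<le> t * C"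
      by (simp add: C_def algebra_simps)
    \<comment> \<open>The weight that puts \<open>x\<close> between \<open>y = x + t *\<^sub>R e\<close> and the opposite point \<open>x - e\<close>.\<close>
    define l where "l = t / (1 + t)"
    have l: "0 \<le> l" "l \<le> 1" "1 - l = 1 / (1 + t)"
      using t by (auto simp: l_def field_simps)
    have yx: "y = x + t *\<^sub>R e"
      using t by (simp add: e_def)
    have x_eq: "x = l *\<^sub>R (x - e) + (1 - l) *\<^sub>R y"
    proof -
      have "l *\<^sub>R (x - e) + (1 - l) *\<^sub>R y = x + ((1 - l) * t - l) *\<^sub>R e"
        unfolding yx by (simp add: algebra_simps)
      also have "(1 - l) * t - l = 0"
        unfolding l(3) by (simp add: l_def)
      finally show ?thesis
        by simp
    qed
    have "x - e - y = - ((1 + t) *\<^sub>R e)"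
      unfolding yx by (simp add: algebra_simps)
    then have "norm (x - e - y) = (1 + t) * s"
      using e t by (simp add: abs_of_pos)
    also have "\<dots> \<le> 2 * s"
      using t s by simp
    finally have xey: "norm (x - e - y) \<le> 2 * s" .
    have "g x \<le> l * g (x - e) + (1 - l) * g y + \<rho> * min l (1 - l) * norm (x - e - y) powr (1 + \<nu>)"
      using paraconvex_on_realD[OF f yS(3,1) l(1,2)] unfolding x_eq[symmetric] g_def .
    also have "\<dots> \<le> l * B + (1 - l) * g y + \<rho> * l * (2 * s) powr (1 + \<nu>)"
      using l t xey ge \<rho> s by (intro add_mono mult_left_mono mult_mono[where a = "_ * _" and d = "_ powr _"] powr_mono2) auto
    finally have "(1 + t) * g x \<le> (1 + t) * (l * B + (1 - l) * g y + \<rho> * l * (2 * s) powr (1 + \<nu>))"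
      using t by (intro mult_left_mono) auto
    also have "\<dots> = ((1 + t) * l) * B + ((1 + t) * (1 - l)) * g y
        + \<rho> * ((1 + t) * l) * (2 * s) powr (1 + \<nu>)"
      by (simp only: algebra_simps)
    also have "\<dots> = t * B + g y + \<rho> * t * (2 * s) powr (1 + \<nu>)"
      using t unfolding l(3) by (simp add: l_def)
    finally have "g x - g y \<le> t * C"
      by (simp add: C_def algebra_simps)
    with upper have "norm (g y - g x) \<le> t * C"
      by (simp add: abs_le_iff)
    then show ?thesis
      by (simp add: t_def mult_ac)
  qed
  have "eventually (\<lambda>y. y \<in> ball x s) (at x)"
    using s by (intro eventually_at_in_open') auto
  then have "eventually (\<lambda>y. norm (g y - g x) \<le> C / s * norm (y - x)) (at x)"
    by eventually_elim (rule bound)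
  moreover have "((\<lambda>y. C / s * norm (y - x)) \<longlongrightarrow> C / s * norm (x - x)) (at x)"
    by (intro tendsto_intros)
  then have "((\<lambda>y. C / s * norm (y - x)) \<longlongrightarrow> 0) (at x)"
    by simp
  ultimately have "((\<lambda>y. g y - g x) \<longlongrightarrow> 0) (at x)"
    by (rule Lim_null_comparison)
  then show ?thesis
    unfolding isCont_def g_def[symmetric] by (simp add: LIM_zero_iff)
qed

section \<open>Clarke subgradients of paraconvex functions\<close>

text \<open>For \<open>v = y - x\<close> and a base point \<open>z\<close> near \<open>x\<close>, paraconvexity between \<open>z\<close> and \<open>z + v\<close> bounds the
  difference quotient \<open>(f (z + t v) - f z) / t\<close> by \<open>f (z + v) - f z + \<rho> * norm v powr (1 + \<nu>)\<close>, uniformly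
  in \<open>t\<close>. The base point moves in Clarke's limit, so continuity at both \<open>x\<close> and \<open>y\<close> is what turns this
  into a bound in terms of \<open>f y - f x\<close>.\<close>

lemma clarke_subgradient_inequality:
  fixes f :: "'a::euclidean_space \<Rightarrow> ereal"
  assumes f: "paraconvex_on S \<nu> \<rho> f" "convex S" "\<And>z. z \<in> S \<Longrightarrow> \<bar>f z\<bar> \<noteq> \<infinity>"
    and \<rho>: "0 \<le> \<rho>" "0 \<le> \<nu>" and S: "open S" "x \<in> S" "y \<in> S"
    and \<zeta>: "\<zeta> \<in> clarke_subdiff f x"
  shows "\<zeta> \<bullet> (y - x) \<le> real_of_ereal (f y) - real_of_ereal (f x) + \<rho> * norm (y - x) powr (1 + \<nu>)"
proof (rule field_le_epsilon)
  fix \<epsilon> :: real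
  assume \<epsilon>: "0 < \<epsilon>"
  define g where "g z = real_of_ereal (f z)" for z
  define v where "v = y - x"
  have fg: "f z = ereal (g z)" if "z \<in> S" for z
    using f(3)[OF that] by (simp add: g_def ereal_real')
  let ?c = "g y - g x + \<rho> * norm v powr (1 + \<nu>) + \<epsilon>"
  have cont: "isCont g z" if "z \<in> S" for z
    using paraconvex_isCont[OF f \<rho> S(1) that] unfolding g_def .
  have gx: "(g \<longlongrightarrow> g x) (nhds x)"
    using cont[OF S(2)] by (simp add: isCont_def tendsto_at_iff_tendsto_nhds)
  have shift: "((\<lambda>z. z + v) \<longlongrightarrow> y) (nhds x)"
    using tendsto_add[OF filterlim_ident[of "nhds x"] tendsto_const[of v]] unfolding v_def by simp
  have gy: "((\<lambda>z. g (z + v)) \<longlongrightarrow> g y) (nhds x)"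
    using isCont_tendsto_compose[OF cont[OF S(3)] shift] .
  have "eventually (\<lambda>z. g (z + v) - g z < g y - g x + \<epsilon>) (nhds x)"
    using tendsto_diff[OF gy gx] \<epsilon> by (intro order_tendstoD) auto
  moreover have "eventually (\<lambda>z. z + v \<in> S) (nhds x)"
    using topological_tendstoD[OF shift S(1,3)] .
  moreover have "eventually (\<lambda>z. z \<in> S) (nhds x)"
    using S by (intro eventually_nhds_in_open)
  ultimately have near: "eventually (\<lambda>z. z \<in> S \<and> z + v \<in> S \<and> g (z + v) - g z < g y - g x + \<epsilon>) (nhds x)"
    by eventually_elim auto
  have small: "eventually (\<lambda>t::real. 0 < t \<and> t < 1) (at_right 0)"
    using eventually_at_right_real[of 0 1] by simp
  have "eventually (\<lambda>(z, t). (f (z + t *\<^sub>R v) - f z) / ereal t \<le> ereal ?c) (nhds x \<times>\<^sub>F at_right 0)"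
    using eventually_prodI[OF near small]
  proof eventually_elim
    case (elim p)
    obtain z t where p: "p = (z, t)"
      by fastforce
    have z: "z \<in> S" "z + v \<in> S" "g (z + v) - g z < g y - g x + \<epsilon>" and t: "0 < t" "t < 1"
      using elim p by auto
    have eq: "z + t *\<^sub>R v = t *\<^sub>R (z + v) + (1 - t) *\<^sub>R z"
      by (simp add: algebra_simps)
    have "z + t *\<^sub>R v \<in> S"
      unfolding eq using z t f(2) by (intro convexD) auto
    have "g (z + t *\<^sub>R v) \<le> t * g (z + v) + (1 - t) * g z
             + \<rho> * min t (1 - t) * norm (z + v - z) powr (1 + \<nu>)"
      unfolding g_def eq using z t by (intro paraconvex_on_realD[OF f]) auto
    also have "\<dots> \<le> t * g (z + v) + (1 - t) * g z + \<rho> * t * norm v powr (1 + \<nu>)"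
      using \<rho> t by (intro add_mono mult_left_mono mult_mono[where a = "_ * _" and d = "_ powr _"]) auto
    finally have "g (z + t *\<^sub>R v) - g z \<le> t * (g (z + v) - g z + \<rho> * norm v powr (1 + \<nu>))"
      by (simp add: algebra_simps)
    also have "\<dots> \<le> t * ?c"
      using z t by (intro mult_left_mono) auto
    finally have "(g (z + t *\<^sub>R v) - g z) / t \<le> ?c"
      using t by (simp add: field_simps)
    then show ?case
      using t by (simp add: p fg[OF \<open>z \<in> S\<close>] fg[OF \<open>z + t *\<^sub>R v \<in> S\<close>])
  qed
  then have "clarke_dir_deriv f x v \<le> ereal ?c"
    unfolding clarke_dir_deriv_def by (intro Limsup_bounded) (simp add: case_prod_beta')
  moreover have "ereal (\<zeta> \<bullet> v) \<le> clarke_dir_deriv f x v"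
    using \<zeta> unfolding clarke_subdiff_def by auto
  ultimately have "ereal (\<zeta> \<bullet> v) \<le> ereal ?c"
    by (rule order_trans[rotated])
  then show "\<zeta> \<bullet> (y - x) \<le> real_of_ereal (f y) - real_of_ereal (f x) + \<rho> * norm (y - x) powr (1 + \<nu>) + \<epsilon>"
    by (simp add: g_def v_def)
qed


section \<open>One step of the projected subgradient method\<close>

text \<open>The exponent in the definition of the tube is the reciprocal of \<open>1 + \<nu> - 1 / \<delta>\<close>, the surplus of the
  order of the paraconvexity error over that of the growth.\<close>

lemma tube_paraconvexity_error:
  fixes \<nu> :: real
  assumes par: "0 < \<rho>" "0 < \<delta>" "0 < \<delta> * (1 + \<nu>) - 1"
    and d: "0 \<le> d" "d \<le> (\<gamma> * \<mu> / \<rho>) powr (\<delta> / (\<delta> * (1 + \<nu>) - 1))" and \<gamma>: "0 \<le> \<gamma> * \<mu>"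
  shows "\<rho> * d powr (1 + \<nu>) \<le> \<gamma> * \<mu> * d powr (1 / \<delta>)"
proof -
  define p where "p = (\<delta> * (1 + \<nu>) - 1) / \<delta>"
  have p: "0 < p" "1 / \<delta> + p = 1 + \<nu>" "\<delta> / (\<delta> * (1 + \<nu>) - 1) = 1 / p"
    using par by (auto simp: p_def field_simps)
  have "d powr p \<le> ((\<gamma> * \<mu> / \<rho>) powr (1 / p)) powr p"
    using d p by (intro powr_mono2) auto
  then have "d powr p \<le> \<gamma> * \<mu> / \<rho>"
    using p par \<gamma> by (simp add: powr_powr)
  then have "\<rho> * d powr p \<le> \<gamma> * \<mu>"
    using par by (simp add: field_simps)
  then have "\<rho> * d powr p * d powr (1 / \<delta>) \<le> \<gamma> * \<mu> * d powr (1 / \<delta>)"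
    by (intro mult_right_mono) auto
  moreover have "d powr (1 + \<nu>) = d powr (1 / \<delta>) * d powr p"
    by (simp add: powr_add flip: p(2))
  ultimately show ?thesis
    by (simp add: mult_ac)
qed

lemma closed_argmin_set:
  fixes f :: "'a::t2_space \<Rightarrow> ereal"
  assumes "closed X" "\<And>z. z \<in> X \<Longrightarrow> \<bar>f z\<bar> \<noteq> \<infinity>" "continuous_on X (\<lambda>z. real_of_ereal (f z))"
  shows "closed (argmin_set f X)"
proof (cases "argmin_set f X = {}")
  case False
  then obtain w where w: "w \<in> X" "\<And>z. z \<in> X \<Longrightarrow> f w \<le> f z"
    unfolding argmin_set_def is_arg_min_def by (auto simp: not_less)
  have real: "f z = ereal (real_of_ereal (f z))" if "z \<in> X" for z
    using assms(2)[OF that] by (simp add: ereal_real')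
  have "argmin_set f X = {z \<in> X. f z \<le> f w}"
    using w unfolding argmin_set_def is_arg_min_def by (auto simp: not_less intro: order_trans)
  also have "\<dots> = {z \<in> X. real_of_ereal (f z) \<le> real_of_ereal (f w)}"
    using real w(1) by (metis (no_types, lifting) ereal_less_eq(3))
  also have "closed \<dots>"
    using assms by (intro continuous_on_closed_Collect_le continuous_on_const)
  finally show ?thesis .
qed simp

lemma projected_normalized_step:
  fixes X :: "'a::euclidean_space set"
  assumes X: "closed X" "convex X" "z \<in> X" and \<zeta>: "\<zeta> \<noteq> 0"
  shows "(norm (closest_point X (x - (\<alpha> / norm \<zeta>) *\<^sub>R \<zeta>) - z))\<^sup>2
           \<le> (norm (x - z))\<^sup>2 - 2 * \<alpha> / norm \<zeta> * (\<zeta> \<bullet> (x - z)) + \<alpha>\<^sup>2"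
proof -
  let ?u = "(\<alpha> / norm \<zeta>) *\<^sub>R \<zeta>"
  have "dist (closest_point X (x - ?u)) (closest_point X z) \<le> dist (x - ?u) z"
    using X by (intro closest_point_lipschitz) auto
  then have "norm (closest_point X (x - ?u) - z) \<le> norm (x - ?u - z)"
    using X by (simp add: closest_point_self dist_norm)
  then have "(norm (closest_point X (x - ?u) - z))\<^sup>2 \<le> (norm ((x - z) - ?u))\<^sup>2"
    by (intro power_mono) (simp_all add: algebra_simps)
  also have "\<dots> = (norm (x - z))\<^sup>2 - 2 * ((x - z) \<bullet> ?u) + (norm ?u)\<^sup>2"
  proof -
    have "(norm (a - b))\<^sup>2 = (norm a)\<^sup>2 - 2 * (a \<bullet> b) + (norm b)\<^sup>2" for a b :: 'a
      by (simp add: power2_norm_eq_inner inner_diff inner_commute)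
    then show ?thesis .
  qed
  also have "norm ?u = \<bar>\<alpha>\<bar>"
    using \<zeta> by simp
  finally show ?thesis
    by (simp add: inner_commute)
qed

text \<open>The hypothesis on \<open>\<rho> * d powr (1 + \<nu>)\<close> leaves half of the growth guaranteed by the error bound, so
  \<open>\<zeta> \<bullet> (x - z) \<ge> \<mu> / 2 * d powr (1 / \<delta>)\<close> for a nearest minimizer \<open>z\<close>. A vanishing subgradient then forces \<open>d powr (1 / \<delta>) = 0\<close>, and the estimate holds for the unchanged iterate.\<close>

lemma subgradient_step_distance:
  fixes f :: "'a::euclidean_space \<Rightarrow> ereal"
  assumes f: "paraconvex_on S \<nu> \<rho> f" "convex S" "\<And>z. z \<in> S \<Longrightarrow> \<bar>f z\<bar> \<noteq> \<infinity>"
    and par: "0 \<le> \<rho>" "0 \<le> \<nu>" "0 < \<mu>" "0 < L" "0 \<le> \<alpha>"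
    and S: "open S" "X \<subseteq> S" and X: "closed X" "convex X" "argmin_set f X \<noteq> {}"
    and eb: "holder_error_bound f X \<mu> \<delta>" and x: "x \<in> X"
    and d: "d = infdist x (argmin_set f X)"
    and err: "\<rho> * d powr (1 + \<nu>) \<le> \<mu> / 2 * d powr (1 / \<delta>)"
    and \<zeta>: "\<zeta> \<in> clarke_subdiff f x" "norm \<zeta> \<le> L"
    and x': "x' = (if \<zeta> = 0 then x else closest_point X (x - (\<alpha> / norm \<zeta>) *\<^sub>R \<zeta>))"
  shows "(infdist x' (argmin_set f X))\<^sup>2 \<le> d\<^sup>2 - \<alpha> * (\<mu> / L) * d powr (1 / \<delta>) + \<alpha>\<^sup>2"
proof -
  define g where "g z = real_of_ereal (f z)" for z
  have fg: "f z = ereal (g z)" if "z \<in> S" for z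
    using f(3)[OF that] by (simp add: g_def ereal_real')
  have "continuous_on X g"
    using paraconvex_isCont[OF f par(1,2) S(1)] S(2) unfolding g_def
    by (intro continuous_at_imp_continuous_on) auto
  then have "closed (argmin_set f X)"
    using X(1) f(3)[OF subsetD[OF S(2)]] unfolding g_def by (intro closed_argmin_set)
  then obtain z where z: "z \<in> argmin_set f X" "d = dist x z"
    using infdist_attains_inf X(3) unfolding d by metis
  have zX: "z \<in> X" and zmin: "\<And>y. y \<in> X \<Longrightarrow> f z \<le> f y"
    using z(1) unfolding argmin_set_def is_arg_min_def by (auto simp: not_less)
  have xz: "d = norm (x - z)"
    using z(2) by (simp add: dist_norm)
  have "(INF y\<in>X. f y) = f z"
    using zX zmin by (intro antisym INF_lower INF_greatest)
  then have growth: "\<mu> * d powr (1 / \<delta>) \<le> g x - g z"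
    using eb x zX S(2) fg[of x] fg[of z] unfolding holder_error_bound_def d by force
  have "\<zeta> \<bullet> (z - x) \<le> g z - g x + \<rho> * norm (z - x) powr (1 + \<nu>)"
    unfolding g_def using S x zX by (intro clarke_subgradient_inequality[OF f par(1,2) S(1) _ _ \<zeta>(1)]) auto
  also have "norm (z - x) = d"
    by (simp add: xz norm_minus_commute)
  finally have angle: "\<mu> / 2 * d powr (1 / \<delta>) \<le> \<zeta> \<bullet> (x - z)"
    using growth err by (simp add: inner_diff_right)
  show ?thesis
  proof (cases "\<zeta> = 0")
    case True
    then have "d powr (1 / \<delta>) \<le> 0"
      using angle par by (simp add: mult_le_0_iff)
    then have "d powr (1 / \<delta>) = 0"
      by simp
    then show ?thesis
      using True x' d by simp
  next
    case False
    have "\<alpha> * (\<mu> / L) * d powr (1 / \<delta>) \<le> \<alpha> * (\<mu> / norm \<zeta>) * d powr (1 / \<delta>)"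
      using par \<zeta> False by (intro mult_right_mono mult_left_mono divide_left_mono mult_pos_pos) auto
    also have "\<dots> = 2 * \<alpha> / norm \<zeta> * (\<mu> / 2 * d powr (1 / \<delta>))"
      by simp
    also have "\<dots> \<le> 2 * \<alpha> / norm \<zeta> * (\<zeta> \<bullet> (x - z))"
      using angle par by (intro mult_left_mono) auto
    finally have decrease: "\<alpha> * (\<mu> / L) * d powr (1 / \<delta>) \<le> 2 * \<alpha> / norm \<zeta> * (\<zeta> \<bullet> (x - z))" .
    have "infdist x' (argmin_set f X) \<le> norm (x' - z)"
      using infdist_le[OF z(1), of x'] by (simp add: dist_norm)
    then have "(infdist x' (argmin_set f X))\<^sup>2 \<le> (norm (x' - z))\<^sup>2"
      by (intro power_mono infdist_nonneg)
    also have "\<dots> \<le> (norm (x - z))\<^sup>2 - 2 * \<alpha> / norm \<zeta> * (\<zeta> \<bullet> (x - z)) + \<alpha>\<^sup>2"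
      using projected_normalized_step[OF X(1,2) zX False] False x' by simp
    finally show ?thesis
      using decrease unfolding xz[symmetric] by linarith
  qed
qed

section \<open>The rate preserved by the distance recursion\<close>

lemma powr_square: "(y powr p)\<^sup>2 = y powr (2 * p)" for y p :: real
  by (simp add: power2_eq_square flip: powr_add)

text \<open>The tangent line at \<open>K\<close> lies below the convex function \<open>K \<mapsto> K powr (- p)\<close>.\<close>

lemma powr_neg_decrement:
  fixes K p :: real
  assumes "0 < K" "0 \<le> p"
  shows "K powr (- p) - p * K powr (- p - 1) \<le> (K + 1) powr (- p)"
proof -
  have "1 - p / K \<le> 1 + (- p * ln (1 + 1 / K))"
    using assms mult_left_mono[OF ln_add_one_self_le_self[of "1 / K"], of p] by simp
  also have "\<dots> \<le> exp (- p * ln (1 + 1 / K))"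
    by (rule exp_ge_add_one_self)
  also have "\<dots> = (1 + 1 / K) powr (- p)"
    using assms by (simp add: powr_def add_pos_pos field_simps)
  finally have "K powr (- p) * (1 - p / K) \<le> K powr (- p) * (1 + 1 / K) powr (- p)"
    by (intro mult_left_mono) auto
  also have "\<dots> = (K + 1) powr (- p)"
    using assms by (simp flip: powr_mult add: distrib_left)
  finally show ?thesis
    using assms by (simp add: powr_diff right_diff_distrib mult.commute)
qed

text \<open>The hypothesis \<open>small\<close> gives \<open>d \<le> (2 * lam / \<tau>) powr \<delta> * K powr (- (\<delta> * r))\<close>, and \<open>\<delta> \<le> 1 \<le> K\<close> lets
  the term \<open>lam\<^sup>2 * K powr (- (2 * r))\<close> be absorbed at the same order. The factor \<open>2 powr (r * \<delta>)\<close> in \<open>A\<close>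
  pays for passing from \<open>K\<close> to \<open>K + 1 \<le> 2 * K\<close>.\<close>

lemma small_distance_step:
  fixes K :: real
  assumes par: "0 < \<delta>" "\<delta> \<le> 1" "0 < r" "0 < \<tau>" "0 < lam" and K: "1 \<le> K"
    and A: "A = 2 powr (r * \<delta>) * sqrt ((2 * lam / \<tau>) powr (2 * \<delta>) + lam\<^sup>2)"
    and d: "0 \<le> d" and d': "0 \<le> d'"
    and small: "\<tau> * d powr (1 / \<delta>) \<le> 2 * (lam * K powr (- r))"
    and step: "d'\<^sup>2 \<le> d\<^sup>2 + (lam * K powr (- r))\<^sup>2"
  shows "d' \<le> A * (K + 1) powr (- (\<delta> * r))"
proof -
  define Q where "Q = (2 * lam / \<tau>) powr (2 * \<delta>) + lam\<^sup>2"
  have Q: "0 \<le> Q"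
    by (simp add: Q_def)
  have "d powr (1 / \<delta>) \<le> 2 * lam / \<tau> * K powr (- r)"
    using small par by (simp add: field_simps)
  then have le: "(d powr (1 / \<delta>)) powr (2 * \<delta>) \<le> (2 * lam / \<tau> * K powr (- r)) powr (2 * \<delta>)"
    using par by (intro powr_mono2) auto
  have d2: "d\<^sup>2 \<le> (2 * lam / \<tau>) powr (2 * \<delta>) * K powr (- (2 * \<delta> * r))"
  proof -
    have "(d powr (1 / \<delta>)) powr (2 * \<delta>) = d\<^sup>2"
      using par d by (simp add: powr_powr powr_numeral)
    moreover have "(2 * lam / \<tau> * K powr (- r)) powr (2 * \<delta>)
        = (2 * lam / \<tau>) powr (2 * \<delta>) * (K powr (- r)) powr (2 * \<delta>)"
      using par by (intro powr_mult)
    moreover have "(K powr (- r)) powr (2 * \<delta>) = K powr (- (2 * \<delta> * r))"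
      by (simp add: powr_powr mult_ac)
    ultimately show ?thesis
      using le by simp
  qed
  have "(lam * K powr (- r))\<^sup>2 = lam\<^sup>2 * K powr (- (2 * r))"
    by (simp add: power_mult_distrib powr_square)
  also have "\<dots> \<le> lam\<^sup>2 * K powr (- (2 * \<delta> * r))"
    using par K by (intro mult_left_mono powr_mono) auto
  finally have "d'\<^sup>2 \<le> Q * K powr (- (2 * \<delta> * r))"
    using step d2 by (simp add: Q_def algebra_simps)
  also have "\<dots> \<le> Q * ((K + 1) / 2) powr (- (2 * \<delta> * r))"
    using par K Q by (intro mult_left_mono powr_mono2') auto
  also have "\<dots> = (A * (K + 1) powr (- (\<delta> * r)))\<^sup>2"
  proof -
    have "((K + 1) / 2) powr (- (2 * \<delta> * r)) = (K + 1) powr (- (2 * \<delta> * r)) * 2 powr (2 * \<delta> * r)"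
      using K by (simp add: powr_divide powr_minus field_simps)
    moreover have "((K + 1) powr (- (\<delta> * r)))\<^sup>2 = (K + 1) powr (- (2 * \<delta> * r))"
      using K by (simp add: powr_square mult_ac)
    moreover have "(2 powr (r * \<delta>))\<^sup>2 = (2::real) powr (2 * \<delta> * r)"
      by (simp add: powr_square mult_ac)
    ultimately show ?thesis
      using Q unfolding A Q_def[symmetric] power_mult_distrib by simp
  qed
  finally show ?thesis
    by (rule power2_le_imp_le) (use Q in \<open>simp add: A flip: Q_def\<close>)
qed

text \<open>As \<open>1 / \<delta> < 2\<close>, the function \<open>e \<mapsto> e\<^sup>2 - c * e powr (1 / \<delta>)\<close> factors into \<open>e powr (1 / \<delta>)\<close>
  and the increasing function \<open>e powr (2 - 1 / \<delta>) - c\<close>. Where it is positive it is therefore increasing,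
  so that the upper bound \<open>E\<close> may replace \<open>d\<close>. At \<open>E\<close> the hypothesis \<open>Kbig\<close> says precisely that the
  decrease covers the drop from \<open>A\<^sup>2 * K powr (- (2 * \<delta> * r))\<close> to its tangent line estimate at \<open>K + 1\<close>.\<close>

lemma large_distance_step:
  fixes K :: real
  assumes par: "1 / 2 < \<delta>" "\<delta> \<le> 1" "0 < r" "0 < \<tau>" "0 < lam" "0 < A" and K: "1 \<le> K"
    and Kbig: "4 * r * \<delta> * A powr ((2 * \<delta> - 1) / \<delta>) / (lam * \<tau>) \<le> K powr (1 - 2 * r * (1 - \<delta>))"
    and d: "0 \<le> d" "d \<le> A * K powr (- (\<delta> * r))"
    and step: "d'\<^sup>2 \<le> d\<^sup>2 - lam * K powr (- r) * \<tau> * d powr (1 / \<delta>) / 2"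
  shows "d' \<le> A * (K + 1) powr (- (\<delta> * r))"
proof -
  define E where "E = A * K powr (- (\<delta> * r))"
  define c where "c = lam * K powr (- r) * \<tau> / 2"
  define q where "q = (2 * \<delta> - 1) / \<delta>"
  have q: "0 \<le> q" "1 / \<delta> + q = 2"
    using par by (auto simp: q_def field_simps)
  have E: "0 < E"
    using par K by (simp add: E_def)
  have split: "e\<^sup>2 - c * e powr (1 / \<delta>) = e powr (1 / \<delta>) * (e powr q - c)" if "0 \<le> e" for e
  proof -
    have "e\<^sup>2 = e powr (1 / \<delta> + q)"
      using that q by (simp add: powr_numeral)
    then show ?thesis
      by (simp add: powr_add algebra_simps)
  qed
  have E2: "E\<^sup>2 = A\<^sup>2 * K powr (- (2 * \<delta> * r))"
    by (simp add: E_def power_mult_distrib powr_square mult_ac)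
  have "E powr (1 / \<delta>) = A powr (1 / \<delta>) * K powr (- r)"
    using par K by (simp add: E_def powr_mult powr_powr)
  then have cE: "c * E powr (1 / \<delta>) = lam * \<tau> / 2 * A powr (1 / \<delta>) * (K powr (- r) * K powr (- r))"
    by (simp add: c_def)
  have "2 * \<delta> * r * A powr q \<le> lam * \<tau> / 2 * K powr (1 - 2 * r * (1 - \<delta>))"
    using Kbig par by (simp add: q_def field_simps)
  then have "2 * \<delta> * r * A powr q * (A powr (1 / \<delta>) * K powr (- (2 * \<delta> * r) - 1))
      \<le> lam * \<tau> / 2 * K powr (1 - 2 * r * (1 - \<delta>)) * (A powr (1 / \<delta>) * K powr (- (2 * \<delta> * r) - 1))"
    by (intro mult_right_mono) auto
  moreover have Aq: "A powr q * A powr (1 / \<delta>) = A\<^sup>2"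
    using q par by (simp add: powr_numeral add.commute flip: powr_add)
  moreover have Kq: "K powr (1 - 2 * r * (1 - \<delta>)) * K powr (- (2 * \<delta> * r) - 1) = K powr (- r) * K powr (- r)"
    by (simp add: algebra_simps flip: powr_add)
  ultimately have drop: "A\<^sup>2 * (2 * \<delta> * r * K powr (- (2 * \<delta> * r) - 1)) \<le> c * E powr (1 / \<delta>)"
    unfolding cE Aq[symmetric] Kq[symmetric] by (simp only: mult_ac)
  have pos: "0 \<le> A * (K + 1) powr (- (\<delta> * r))"
    using par by simp
  have dd: "d'\<^sup>2 \<le> d powr (1 / \<delta>) * (d powr q - c)"
    using step split[OF d(1)] by (simp add: c_def mult_ac)
  have "d'\<^sup>2 \<le> (A * (K + 1) powr (- (\<delta> * r)))\<^sup>2"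
  proof (cases "d powr q \<le> c")
    case True
    then have "d powr (1 / \<delta>) * (d powr q - c) \<le> 0"
      by (intro mult_nonneg_nonpos) auto
    then show ?thesis
      using dd by (smt (verit) zero_le_power2)
  next
    case False
    have "d'\<^sup>2 \<le> d powr (1 / \<delta>) * (d powr q - c)"
      by (rule dd)
    also have "\<dots> \<le> E powr (1 / \<delta>) * (E powr q - c)"
      using False d q par unfolding E_def[symmetric]
      by (intro mult_mono diff_right_mono powr_mono2) auto
    also have "\<dots> = E\<^sup>2 - c * E powr (1 / \<delta>)"
      using split[of E] E by simp
    also have "\<dots> \<le> A\<^sup>2 * (K powr (- (2 * \<delta> * r)) - 2 * \<delta> * r * K powr (- (2 * \<delta> * r) - 1))"
      using drop unfolding E2 by (simp add: right_diff_distrib)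
    also have "\<dots> \<le> A\<^sup>2 * (K + 1) powr (- (2 * \<delta> * r))"
      using K par by (intro mult_left_mono powr_neg_decrement) auto
    also have "\<dots> = (A * (K + 1) powr (- (\<delta> * r)))\<^sup>2"
      by (simp add: power_mult_distrib powr_square mult_ac)
    finally show ?thesis .
  qed
  then show ?thesis
    using pos by (rule power2_le_imp_le)
qed

text \<open>The threshold \<open>2 * \<alpha>\<close> splits the cases: above it, half of the decrease \<open>\<alpha> * \<tau> * d powr (1 / \<delta>)\<close>
  pays for the increment \<open>\<alpha>\<^sup>2\<close> and the other half remains.\<close>

lemma distance_rate_step:
  fixes K :: real
  assumes par: "1 / 2 < \<delta>" "\<delta> \<le> 1" "0 < r" "0 < \<tau>" "0 < lam" and K: "1 \<le> K"
    and A: "A = 2 powr (r * \<delta>) * sqrt ((2 * lam / \<tau>) powr (2 * \<delta>) + lam\<^sup>2)"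
    and Kbig: "4 * r * \<delta> * A powr ((2 * \<delta> - 1) / \<delta>) / (lam * \<tau>) \<le> K powr (1 - 2 * r * (1 - \<delta>))"
    and d: "0 \<le> d" "d \<le> A * K powr (- (\<delta> * r))" and d': "0 \<le> d'"
    and step: "d'\<^sup>2 \<le> d\<^sup>2 - lam * K powr (- r) * \<tau> * d powr (1 / \<delta>) + (lam * K powr (- r))\<^sup>2"
  shows "d' \<le> A * (K + 1) powr (- (\<delta> * r))"
proof -
  define \<alpha> where "\<alpha> = lam * K powr (- r)"
  have \<alpha>: "0 < \<alpha>"
    using par K by (simp add: \<alpha>_def)
  have step': "d'\<^sup>2 \<le> d\<^sup>2 - \<alpha> * (\<tau> * d powr (1 / \<delta>)) + \<alpha> * \<alpha>"
    using step by (simp add: \<alpha>_def power2_eq_square mult_ac)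
  show ?thesis
  proof (cases "\<tau> * d powr (1 / \<delta>) \<le> 2 * \<alpha>")
    case True
    have "0 \<le> \<alpha> * (\<tau> * d powr (1 / \<delta>))"
      using \<alpha> par by simp
    then have "d'\<^sup>2 \<le> d\<^sup>2 + \<alpha>\<^sup>2"
      using step' by (simp add: power2_eq_square)
    then show ?thesis
      using True par K A d d' unfolding \<alpha>_def by (intro small_distance_step) auto
  next
    case False
    then have "\<alpha> * (2 * \<alpha>) \<le> \<alpha> * (\<tau> * d powr (1 / \<delta>))"
      using \<alpha> by (intro mult_left_mono) auto
    then have "d'\<^sup>2 \<le> d\<^sup>2 - \<alpha> * \<tau> * d powr (1 / \<delta>) / 2"
      using step' by (simp add: mult_ac)
    moreover have "0 < A"
      using par unfolding A by (auto intro!: mult_pos_pos add_nonneg_pos)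
    ultimately show ?thesis
      using par K Kbig d unfolding \<alpha>_def by (intro large_distance_step) auto
  qed
qed

section \<open>Convergence rate\<close>

theorem theorem4p8:
  fixes f :: "real ^ 'n \<Rightarrow> ereal"
    and X X' :: "(real ^ 'n) set"
    and x \<zeta> :: "nat \<Rightarrow> real ^ 'n"
    and \<rho> \<nu> \<delta> \<mu> L \<tau> r lam A k\<^sub>0 :: real
  assumes f_proper: "proper_fun f"
    and X: "X \<noteq> {}" "closed X" "convex X" "X \<subseteq> edom f"
    and argmin_nonempty: "argmin_set f X \<noteq> {}"
    and params: "\<rho> > 0" "0 < \<nu>" "\<nu> \<le> 1" "1 / (1 + \<nu>) < \<delta>" "\<delta> \<le> 1" "\<mu> > 0"
    and X': "open X'" "convex X'" "X \<subseteq> X'" "X' \<subseteq> edom f"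
    and f_paraconvex: "paraconvex_on X' \<nu> \<rho> f"
    and error_bound: "holder_error_bound f X \<mu> \<delta>"
    and L: "ereal L = Sup {ereal (norm \<xi>) | \<xi> y. y \<in> tube f X \<rho> \<nu> \<delta> \<mu> 1 \<and> \<xi> \<in> clarke_subdiff f y}"
    and L_pos: "0 < L"
    and \<tau>: "\<tau> = \<mu> / L"
    and r: "0 < r" "r < 1"
    and lam: "lam > 0"
    and A: "A = 2 powr (r * \<delta>) * sqrt ((2 * lam / \<tau>) powr (2 * \<delta>) + lam\<^sup>2)"
    and k0: "k\<^sub>0 = Max {(4 * r * \<delta> * A powr ((2 * \<delta> - 1) / \<delta>) / (lam * \<tau>)) powr (1 / (1 - 2 * r * (1 - \<delta>))),
                      A powr (1 / (\<delta> * r)) * (2 * \<rho> / \<mu>) powr (1 / (r * (\<delta> * (1 + \<nu>) - 1))),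
                      1}"
    and iterates: "proj_subgrad_method f X (\<lambda>k. lam * (real k + k\<^sub>0) powr (- r)) \<zeta> x"
    and x0_tube: "x 0 \<in> tube f X \<rho> \<nu> \<delta> \<mu> (1 / 2)"
    and x0_dist: "infdist (x 0) (argmin_set f X) \<le> min ((2 * lam / \<tau>) powr \<delta>) (A * k\<^sub>0 powr (- \<delta> * r))"
  shows "\<forall>k. infdist (x k) (argmin_set f X) \<le> A / (real k + k\<^sub>0) powr (\<delta> * r)"
proof -
  let ?d = "\<lambda>k. infdist (x k) (argmin_set f X)"
  let ?K = "\<lambda>k. real k + k\<^sub>0"
  define e where "e = \<delta> / (\<delta> * (1 + \<nu>) - 1)"
  have D: "0 < \<delta> * (1 + \<nu>) - 1"
    using params by (simp add: field_simps)
  have "1 / 2 \<le> 1 / (1 + \<nu>)"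
    using params by (simp add: field_simps)
  then have \<delta>: "1 / 2 < \<delta>"
    using params by linarith
  have e: "0 < e"
    using \<delta> D by (simp add: e_def)
  have \<tau>pos: "0 < \<tau>"
    using \<tau> params L_pos by simp
  have Apos: "0 < A"
    using lam unfolding A by (auto intro!: mult_pos_pos add_nonneg_pos)
  have expo: "0 < 1 - 2 * r * (1 - \<delta>)"
  proof -
    have "r * (1 - \<delta>) \<le> 1 * (1 - \<delta>)"
      using r params by (intro mult_right_mono) auto
    then show ?thesis
      using \<delta> by simp
  qed
  have fin: "\<bar>f z\<bar> \<noteq> \<infinity>" if "z \<in> X'" for z
    using f_proper X'(4) that unfolding proper_fun_def edom_def by auto

  define P where "P = 4 * r * \<delta> * A powr ((2 * \<delta> - 1) / \<delta>) / (lam * \<tau>)"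
  define R where "R = A powr (1 / (\<delta> * r)) * (2 * \<rho> / \<mu>) powr (1 / (r * (\<delta> * (1 + \<nu>) - 1)))"
  have k0_ge: "P powr (1 / (1 - 2 * r * (1 - \<delta>))) \<le> k\<^sub>0" "R \<le> k\<^sub>0" "1 \<le> k\<^sub>0"
    unfolding k0 P_def R_def by auto
  have Kbig: "P \<le> ?K k powr (1 - 2 * r * (1 - \<delta>))" for k
  proof -
    have "0 \<le> P"
      using r \<delta> lam \<tau>pos by (simp add: P_def)
    then have "P = (P powr (1 / (1 - 2 * r * (1 - \<delta>)))) powr (1 - 2 * r * (1 - \<delta>))"
      using expo by (simp add: powr_powr)
    also have "\<dots> \<le> ?K k powr (1 - 2 * r * (1 - \<delta>))"
      using expo k0_ge by (intro powr_mono2) auto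
    finally show ?thesis .
  qed
  \<comment> \<open>The bound to be proved keeps the iterates in the (closed) tube of parameter \<open>1 / 2\<close>.\<close>
  have in_tube: "A * ?K k powr (- (\<delta> * r)) \<le> (1 / 2 * \<mu> / \<rho>) powr e" for k
  proof -
    have Rpos: "0 < R"
      using Apos params by (simp add: R_def)
    have "?K k powr (- (\<delta> * r)) \<le> R powr (- (\<delta> * r))"
      using Rpos k0_ge r \<delta> by (intro powr_mono2') auto
    also have "\<dots> = (A powr (1 / (\<delta> * r))) powr (- (\<delta> * r))
        * ((2 * \<rho> / \<mu>) powr (1 / (r * (\<delta> * (1 + \<nu>) - 1)))) powr (- (\<delta> * r))"
      unfolding R_def by (intro powr_mult)
    also have "(A powr (1 / (\<delta> * r))) powr (- (\<delta> * r)) = 1 / A"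
      using Apos r \<delta> by (simp add: powr_powr powr_minus_divide)
    also have "((2 * \<rho> / \<mu>) powr (1 / (r * (\<delta> * (1 + \<nu>) - 1)))) powr (- (\<delta> * r))
        = (2 * \<rho> / \<mu>) powr (- e)"
      using r by (simp add: powr_powr e_def)
    also have "\<dots> = (1 / 2 * \<mu> / \<rho>) powr e"
    proof -
      have "1 / 2 * \<mu> / \<rho> = inverse (2 * \<rho> / \<mu>)"
        by (simp add: field_simps)
      then show ?thesis
        using params by (simp add: powr_minus inverse_powr del: inverse_divide)
    qed
    finally have "A * ?K k powr (- (\<delta> * r)) \<le> A * (1 / A * (1 / 2 * \<mu> / \<rho>) powr e)"
      using Apos by (intro mult_left_mono) auto
    then show ?thesis
      using Apos by simp
  qed
  \<comment> \<open>Subgradients are bounded by \<open>L\<close> on the open tube of parameter \<open>1\<close>, which contains that closed tube.\<close>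
  have half_one: "(1 / 2 * \<mu> / \<rho>) powr e < (1 * \<mu> / \<rho>) powr e"
    using e params by (intro powr_less_mono2 divide_strict_right_mono) auto
  have subgrad_le_L: "norm \<xi> \<le> L" if "y \<in> tube f X \<rho> \<nu> \<delta> \<mu> 1" "\<xi> \<in> clarke_subdiff f y" for y \<xi>
  proof -
    have "ereal (norm \<xi>) \<le> ereal L"
      unfolding L using that by (intro Sup_upper) blast
    then show ?thesis
      by simp
  qed

  have main: "x k \<in> X \<and> ?d k \<le> A * ?K k powr (- (\<delta> * r))" for k
  proof (induction k)
    case 0
    show ?case
      using x0_tube x0_dist by (simp add: tube_def)
  next
    case (Suc k)
    let ?\<alpha> = "lam * ?K k powr (- r)"
    have small: "?d k \<le> (1 / 2 * \<mu> / \<rho>) powr e"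
      using Suc in_tube[of k] by linarith
    have tube1: "x k \<in> tube f X \<rho> \<nu> \<delta> \<mu> 1"
      using Suc small half_one by (simp add: tube_def e_def)
    have \<zeta>: "\<zeta> k \<in> clarke_subdiff f (x k)"
      and x_Suc: "x (Suc k) = (if \<zeta> k = 0 then x k
                    else closest_point X (x k - (?\<alpha> / norm (\<zeta> k)) *\<^sub>R \<zeta> k))"
      using iterates unfolding proj_subgrad_method_def by auto
    have err: "\<rho> * ?d k powr (1 + \<nu>) \<le> \<mu> / 2 * ?d k powr (1 / \<delta>)"
      using tube_paraconvexity_error[OF params(1) _ D infdist_nonneg small[unfolded e_def]] params \<delta>
      by simp
    have "(?d (Suc k))\<^sup>2 \<le> (?d k)\<^sup>2 - ?\<alpha> * (\<mu> / L) * ?d k powr (1 / \<delta>) + ?\<alpha>\<^sup>2"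
      using Suc params L_pos lam \<zeta> subgrad_le_L[OF tube1 \<zeta>]
      by (intro subgradient_step_distance[OF f_paraconvex X'(2) fin _ _ _ _ _ X'(1,3) X(2,3)
            argmin_nonempty error_bound _ refl err _ _ x_Suc]) auto
    then have "?d (Suc k) \<le> A * (?K k + 1) powr (- (\<delta> * r))"
      using \<delta> params r \<tau>pos lam k0_ge Kbig[of k] Suc A unfolding P_def \<tau>[symmetric]
      by (intro distance_rate_step[where d = "?d k" and \<tau> = \<tau>] infdist_nonneg) auto
    moreover have "x (Suc k) \<in> X"
      using Suc X by (simp add: x_Suc closest_point_in_set)
    ultimately show ?case
      by (simp add: add_ac)
  qed
  show ?thesis
    using main by (simp add: powr_minus divide_inverse)
qed

end
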